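(* $\diamondsuit(\operatorname{non}(\mathcal{M}))$ implies the existence of a Suslin tree.
   Context: $2^{<\omega_1}$ is the set of all functions from a countable ordinal into $2=\{0,1\}$. For a Borel subset $A$ of a Polish space, a map $F:2^{<\omega_1}\to A$ is Borel if for every $\delta<\omega_1$ the restriction of $F$ to $2^\delta$ (with the product topology) is a Borel map. For $A$, $B$ and $E\subseteq A\times B$ Borel subsets of Polish spaces, $\diamondsuit(A,B,E)$ is the statement: for every Borel map $F:2^{<\omega_1}\to A$ there is $g:\omega_1\to B$ such that for every $f:\omega_1\to 2$ the set $\{\alpha\in\omega_1: F(f\restriction\alpha)\,E\,g(\alpha)\}$ is stationary in $\omega_1$. $\operatorname{non}(\mathcal{M})$ denotes the invariant $(\mathcal{M},\mathbb{R},\not\ni)$, where $\mathcal{M}$ is the ideal of meager sets. As a Borel invariant, it is represented by (codes for) $F_\sigma$ meager sets. Concretely, identify $\mathbb{R}$ with $2^\omega$; let $A$ be the set of sequences $\langle T_n:n\in\omega\rangle$ of trees $T_n\subseteq 2^{<\omega}$ such that every $s\in 2^{<\omega}$ has an extension $t\in2^{<\omega}$ with $t\notin T_n$; let $B=2^\omega$; and put $\langle T_n\rangle\,E\,x$ iff $x\notin\bigcup_n[T_n]$, where $[T_n]$ is the set of infinite branches of $T_n$. A Suslin tree is a tree of height $\omega_1$ with no uncountable chains and no uncountable antichains. *)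

theory Defs
  imports "HOL-Analysis.Analysis" "HOL-Library.Sublist" "HOL-Library.Countable_Set_Type"
begin

unbundle cardinal_syntax

section \<open>The ordinal \<open>\<omega>\<^sub>1\<close>\<close>

text \<open>The elements of the type \<open>omega1\<close> are the countable ordinals; an ordinal \<open>\<alpha> < \<omega>\<^sub>1\<close> is
  identified with its set of predecessors \<open>{..<\<alpha>}\<close>.\<close>

typedef omega1 = "Field (cardSuc natLeq)"
proof -
  have "Field (cardSuc natLeq) \<noteq> {}"
    using infinite_cardSuc_regularCard[of natLeq] cardSuc_finite[of natLeq] natLeq_Card_order
    by (metis Field_natLeq finite.emptyI infinite_UNIV_nat)
  then show ?thesis by blast
qed

lemma Card_order_cardSuc_natLeq: "Card_order (cardSuc natLeq)"
  by (rule cardSuc_Card_order[OF natLeq_Card_order])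

lemma Well_order_cardSuc_natLeq: "Well_order (cardSuc natLeq)"
  using Card_order_cardSuc_natLeq by (simp add: card_order_on_def)

instantiation omega1 :: linorder
begin

definition less_eq_omega1 :: "omega1 \<Rightarrow> omega1 \<Rightarrow> bool"
  where "\<alpha> \<le> \<beta> \<longleftrightarrow> (Rep_omega1 \<alpha>, Rep_omega1 \<beta>) \<in> cardSuc natLeq"

definition less_omega1 :: "omega1 \<Rightarrow> omega1 \<Rightarrow> bool"
  where "\<alpha> < \<beta> \<longleftrightarrow> \<alpha> \<le> \<beta> \<and> \<not> \<beta> \<le> (\<alpha>::omega1)"

instance
proof
  have L: "Linear_order (cardSuc natLeq)"
    using Well_order_cardSuc_natLeq by (simp add: well_order_on_def)
  then have refl: "Refl (cardSuc natLeq)" and trans: "trans (cardSuc natLeq)"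
    and anti: "antisym (cardSuc natLeq)" and tot: "Total (cardSuc natLeq)"
    by (auto simp: order_on_defs)
  fix x y z :: omega1
  show "x < y \<longleftrightarrow> x \<le> y \<and> \<not> y \<le> x" by (simp add: less_omega1_def)
  show xx: "x \<le> x" for x :: omega1
    using refl Rep_omega1[of x] by (auto simp: less_eq_omega1_def refl_on_def)
  show "x \<le> y \<Longrightarrow> y \<le> z \<Longrightarrow> x \<le> z"
    using trans by (auto simp: less_eq_omega1_def trans_def)
  show "x \<le> y \<Longrightarrow> y \<le> x \<Longrightarrow> x = y"
    using antisymD[OF anti, of "Rep_omega1 x" "Rep_omega1 y"]
    by (simp add: less_eq_omega1_def Rep_omega1_inject)
  show "x \<le> y \<or> y \<le> x"
    using tot Rep_omega1[of x] Rep_omega1[of y] xx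
    by (cases "x = y") (auto simp: less_eq_omega1_def total_on_def Rep_omega1_inject)
qed

end

instance omega1 :: wellorder
proof
  fix P :: "omega1 \<Rightarrow> bool" and a :: omega1
  assume step: "\<And>x. (\<And>y. y < x \<Longrightarrow> P y) \<Longrightarrow> P x"
  have "wf (cardSuc natLeq - Id)"
    using Well_order_cardSuc_natLeq by (simp add: well_order_on_def)
  then have "wf (inv_image (cardSuc natLeq - Id) Rep_omega1)" by (rule wf_inv_image)
  then show "P a"
  proof (induction a rule: wf_induct_rule)
    case (less x)
    show ?case
    proof (rule step)
      fix y assume "y < x"
      then have "(Rep_omega1 y, Rep_omega1 x) \<in> cardSuc natLeq - Id"
        by (auto simp: less_omega1_def less_eq_omega1_def Rep_omega1_inject)
      then show "P y" using less by (simp add: inv_image_def)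
    qed
  qed
qed

text \<open>The order on \<open>omega1\<close> has type \<open>\<omega>\<^sub>1\<close>: it is a well-order with uncountable domain all of
  whose proper initial segments are countable.\<close>

lemma uncountable_omega1: "uncountable (UNIV :: omega1 set)"
proof
  assume "countable (UNIV :: omega1 set)"
  then have "countable (Rep_omega1 ` UNIV)" by simp
  then have "countable (Field (cardSuc natLeq))"
    using type_definition.Rep_range[OF type_definition_omega1] by simp
  then have "|Field (cardSuc natLeq)| \<le>o natLeq" by (simp add: countable_card_le_natLeq)
  then have "cardSuc natLeq \<le>o natLeq"
    using card_of_Field_ordIso[OF Card_order_cardSuc_natLeq]
    by (metis ordIso_ordLeq_trans ordIso_symmetric)
  then show False
    using cardSuc_greater[OF natLeq_Card_order] not_ordLess_ordLeq by blast
qed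

lemma countable_lessThan_omega1: "countable {..<\<alpha>::omega1}"
proof -
  have "|underS (cardSuc natLeq) (Rep_omega1 \<alpha>)| <o cardSuc natLeq"
    by (rule card_of_underS[OF Card_order_cardSuc_natLeq Rep_omega1])
  then have "|underS (cardSuc natLeq) (Rep_omega1 \<alpha>)| \<le>o natLeq"
    using cardSuc_ordLeq_ordLess[OF natLeq_Card_order card_of_Card_order] by blast
  then have "countable (underS (cardSuc natLeq) (Rep_omega1 \<alpha>))"
    by (simp add: countable_card_le_natLeq)
  moreover have "Rep_omega1 ` {..<\<alpha>} \<subseteq> underS (cardSuc natLeq) (Rep_omega1 \<alpha>)"
    by (auto simp: underS_def less_omega1_def less_eq_omega1_def Rep_omega1_inject)
  ultimately have "countable (Rep_omega1 ` {..<\<alpha>})" by (rule countable_subset[rotated])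
  moreover have "inj_on Rep_omega1 {..<\<alpha>}" by (simp add: inj_on_def Rep_omega1_inject)
  ultimately show ?thesis by (rule countable_image_inj_on)
qed


section \<open>Stationary sets\<close>

definition unbounded_omega1 :: "omega1 set \<Rightarrow> bool"
  where "unbounded_omega1 C \<longleftrightarrow> (\<forall>\<alpha>. \<exists>\<beta>\<in>C. \<alpha> < \<beta>)"

text \<open>The premises on \<open>\<delta>\<close> say that \<open>\<delta>\<close> is a nonzero limit ordinal with \<open>sup (C \<inter> \<delta>) = \<delta>\<close>.\<close>

definition closed_omega1 :: "omega1 set \<Rightarrow> bool"
  where "closed_omega1 C \<longleftrightarrow>
    (\<forall>\<delta>. {..<\<delta>} \<noteq> {} \<and> (\<forall>\<gamma><\<delta>. \<exists>\<beta>\<in>C. \<gamma> < \<beta> \<and> \<beta> < \<delta>) \<longrightarrow> \<delta> \<in> C)"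

definition club :: "omega1 set \<Rightarrow> bool"
  where "club C \<longleftrightarrow> closed_omega1 C \<and> unbounded_omega1 C"

definition stationary :: "omega1 set \<Rightarrow> bool"
  where "stationary S \<longleftrightarrow> (\<forall>C. club C \<longrightarrow> S \<inter> C \<noteq> {})"


section \<open>Borel maps on \<open>2\<^bsup><\<omega>\<^sub>1\<^esup>\<close> and the parametrized diamond\<close>

text \<open>The set \<open>2\<close> is \<open>bool\<close>, and \<open>2\<^sup>\<delta>\<close> is the set of extensional functions on \<open>{..<\<delta>}\<close>. Such a
  function does not determine \<open>\<delta>\<close> in HOL (it may be constantly \<open>undefined\<close> from some point on),
  so an element of \<open>2\<^bsup><\<omega>\<^sub>1\<^esup>\<close> is represented by a pair of \<open>\<delta>\<close> and a function in \<open>2\<^sup>\<delta>\<close>.\<close>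

definition two_pow :: "omega1 \<Rightarrow> (omega1 \<Rightarrow> bool) topology"
  where "two_pow \<delta> = product_topology (\<lambda>_. discrete_topology UNIV) {..<\<delta>}"

definition borel_of_topology :: "'a topology \<Rightarrow> 'a measure"
  where "borel_of_topology X = sigma (topspace X) {U. openin X U}"

text \<open>Values of \<open>F\<close> at pairs \<open>(\<delta>, s)\<close> with \<open>s \<notin> 2\<^sup>\<delta>\<close> are irrelevant. Measurability into
  \<open>restrict_space borel A\<close> includes that \<open>F\<close> takes values in \<open>A\<close>.\<close>

definition borel_map :: "(omega1 \<times> (omega1 \<Rightarrow> bool) \<Rightarrow> 'a::topological_space) \<Rightarrow> 'a set \<Rightarrow> bool"
  where "borel_map F A \<longleftrightarrow>
    (\<forall>\<delta>. (\<lambda>s. F (\<delta>, s)) \<in> borel_of_topology (two_pow \<delta>) \<rightarrow>\<^sub>M restrict_space borel A)"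

definition seg :: "(omega1 \<Rightarrow> bool) \<Rightarrow> omega1 \<Rightarrow> omega1 \<times> (omega1 \<Rightarrow> bool)"
  where "seg f \<alpha> = (\<alpha>, restrict f {..<\<alpha>})"

text \<open>The principle is meant for triples satisfying \<open>borel_invariant\<close>, defined below.\<close>

definition diamond :: "'a::topological_space set \<Rightarrow> 'b::topological_space set \<Rightarrow> ('a \<times> 'b) set \<Rightarrow> bool"
  where "diamond A B E \<longleftrightarrow>
    (\<forall>F. borel_map F A \<longrightarrow>
      (\<exists>g :: omega1 \<Rightarrow> 'b. range g \<subseteq> B \<and>
        (\<forall>f. stationary {\<alpha>. (F (seg f \<alpha>), g \<alpha>) \<in> E})))"

definition polish_topology :: "'a topology \<Rightarrow> bool"
  where "polish_topology X \<longleftrightarrow> completely_metrizable_space X \<and> second_countable X"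

definition borel_invariant ::
    "'a::topological_space set \<Rightarrow> 'b::topological_space set \<Rightarrow> ('a \<times> 'b) set \<Rightarrow> bool"
  where "borel_invariant A B E \<longleftrightarrow>
    polish_topology (euclidean :: 'a topology) \<and> polish_topology (euclidean :: 'b topology) \<and>
    A \<in> sets borel \<and> B \<in> sets borel \<and> E \<in> sets borel \<and> E \<subseteq> A \<times> B"


section \<open>The invariant \<open>non(\<M>)\<close>\<close>

text \<open>A set of finite binary sequences is given by its characteristic function of type
  \<open>bool list \<Rightarrow> bool\<close>, and \<open>2\<^sup>\<omega>\<close> is \<open>nat \<Rightarrow> bool\<close>, so that the library's product topology on
  function types applies to both.\<close>

definition bin_tree :: "(bool list \<Rightarrow> bool) \<Rightarrow> bool"
  where "bin_tree T \<longleftrightarrow> (\<forall>t s. T t \<and> prefix s t \<longrightarrow> T s)"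

definition branches :: "(bool list \<Rightarrow> bool) \<Rightarrow> (nat \<Rightarrow> bool) set"
  where "branches T = {x. \<forall>k. T (map x [0..<k])}"

definition nonM_A :: "(nat \<Rightarrow> bool list \<Rightarrow> bool) set"
  where "nonM_A = {T. \<forall>n. bin_tree (T n) \<and> (\<forall>s. \<exists>t. prefix s t \<and> \<not> T n t)}"

definition nonM_B :: "(nat \<Rightarrow> bool) set"
  where "nonM_B = UNIV"

definition nonM_E :: "((nat \<Rightarrow> bool list \<Rightarrow> bool) \<times> (nat \<Rightarrow> bool)) set"
  where "nonM_E = {(T, x). T \<in> nonM_A \<and> x \<in> nonM_B \<and> x \<notin> (\<Union>n. branches (T n))}"

instance bool :: second_countable_topology
proof
  have "generate_topology (UNIV :: bool set set) S" for S
    by (simp add: generate_topology.Basis)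
  then have "open = generate_topology (UNIV :: bool set set)"
    by (auto simp: fun_eq_iff open_discrete)
  then show "\<exists>B :: bool set set. countable B \<and> open = generate_topology B"
    by (metis countable_finite finite)
qed

lemma second_countable_euclidean:
  "second_countable (euclidean :: 'a::second_countable_topology topology)"
proof -
  obtain \<B> :: "'a set set" where \<B>: "countable \<B>" "\<And>C. C \<in> \<B> \<Longrightarrow> open C"
    and union: "\<And>S. open S \<Longrightarrow> \<exists>U. U \<subseteq> \<B> \<and> S = \<Union>U"
    using univ_second_countable by metis
  have "\<exists>V\<in>\<B>. x \<in> V \<and> V \<subseteq> S" if "open S" "x \<in> S" for S x
    using union[OF that(1)] that(2) by (metis Union_iff Union_upper subsetD)
  then show ?thesis
    unfolding second_countable_def using \<B> by (intro exI[of _ \<B>]) simp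
qed

lemma completely_metrizable_bool: "completely_metrizable_space (euclidean :: bool topology)"
proof -
  have "(euclidean :: bool topology) = discrete_topology UNIV"
    by (simp add: topology_eq open_discrete)
  then show ?thesis by (simp add: completely_metrizable_space_discrete_topology)
qed

lemma completely_metrizable_fun:
  assumes "completely_metrizable_space (euclidean :: 'b::topological_space topology)"
  shows "completely_metrizable_space (euclidean :: ('a::countable \<Rightarrow> 'b) topology)"
proof -
  have "completely_metrizable_space
      (product_topology (\<lambda>_. euclidean :: 'b topology) (UNIV :: 'a set))"
    unfolding completely_metrizable_space_product_topology
    using assms by (auto intro: countable_subset[OF subset_UNIV])
  then show ?thesis by (simp add: euclidean_product_topology)
qed

lemma borel_invariant_nonM: "borel_invariant nonM_A nonM_B nonM_E"
proof -
  let ?I = "\<lambda>n s. {T :: nat \<Rightarrow> bool list \<Rightarrow> bool. T n s}"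
  have cont: "continuous_on UNIV (\<lambda>T :: nat \<Rightarrow> bool list \<Rightarrow> bool. T n s)" for n s
    by (rule continuous_on_product_then_coordinatewise
        [OF continuous_on_product_coordinates[where 'b = "bool list \<Rightarrow> bool" and i = n]])
  have meas [measurable]: "(\<lambda>T :: nat \<Rightarrow> bool list \<Rightarrow> bool. T n s) \<in> borel \<rightarrow>\<^sub>M count_space UNIV" for n s
    using borel_measurable_continuous_onI[OF cont[of n s]]
    by (simp add: measurable_cong_sets[OF refl sets_borel_eq_count_space])
  have A: "nonM_A \<in> sets borel"
  proof -
    have "Measurable.pred borel (\<lambda>T :: nat \<Rightarrow> bool list \<Rightarrow> bool.
        \<forall>n. (\<forall>t s. T n t \<and> prefix s t \<longrightarrow> T n s) \<and> (\<forall>s. \<exists>t. prefix s t \<and> \<not> T n t))"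
      by measurable
    then show ?thesis
      unfolding nonM_A_def bin_tree_def by (simp add: pred_def)
  qed
  have E: "nonM_E \<in> sets borel"
  proof -
    let ?p = "\<lambda>(p :: (nat \<Rightarrow> bool list \<Rightarrow> bool) \<times> (nat \<Rightarrow> bool)) n k.
      \<exists>s. (length s = k \<and> (\<forall>i<k. snd p i = s ! i)) \<and> fst p n s"
    have [measurable]: "(fst :: (nat \<Rightarrow> bool list \<Rightarrow> bool) \<times> (nat \<Rightarrow> bool) \<Rightarrow> _) \<in> borel \<rightarrow>\<^sub>M borel"
      by (intro borel_measurable_continuous_onI continuous_on_fst continuous_on_id)
    have "continuous_on UNIV (\<lambda>p :: (nat \<Rightarrow> bool list \<Rightarrow> bool) \<times> (nat \<Rightarrow> bool). snd p i)" for i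
      by (rule continuous_on_product_then_coordinatewise[OF continuous_on_snd[OF continuous_on_id]])
    from borel_measurable_continuous_onI[OF this]
    have [measurable]: "(\<lambda>p :: (nat \<Rightarrow> bool list \<Rightarrow> bool) \<times> (nat \<Rightarrow> bool). snd p i)
        \<in> borel \<rightarrow>\<^sub>M count_space UNIV" for i
      by (simp add: measurable_cong_sets[OF refl sets_borel_eq_count_space])
    note [measurable] = A
    have eq: "fst p n (map (snd p) [0..<k]) \<longleftrightarrow> ?p p n k" for p n k
    proof
      assume "fst p n (map (snd p) [0..<k])"
      then show "?p p n k" by (intro exI[of _ "map (snd p) [0..<k]"]) auto
    next
      assume "?p p n k"
      then obtain s where s: "length s = k" "\<forall>i<k. snd p i = s ! i" "fst p n s" by blast
      then have "map (snd p) [0..<k] = s" by (intro nth_equalityI) auto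
      then show "fst p n (map (snd p) [0..<k])" using s by simp
    qed
    have "nonM_E = {p. fst p \<in> nonM_A \<and> (\<forall>n. \<exists>k. \<not> fst p n (map (snd p) [0..<k]))}"
      by (auto simp: nonM_E_def nonM_B_def branches_def)
    then have "nonM_E = {p. fst p \<in> nonM_A \<and> (\<forall>n. \<exists>k. \<not> ?p p n k)}"
      unfolding eq .
    moreover have "Measurable.pred borel (\<lambda>p. fst p \<in> nonM_A \<and> (\<forall>n. \<exists>k. \<not> ?p p n k))"
      by measurable
    ultimately show ?thesis by (simp add: pred_def)
  qed
  show ?thesis
    unfolding borel_invariant_def polish_topology_def
    using A E
    by (auto simp: nonM_B_def nonM_E_def second_countable_euclidean completely_metrizable_fun
        completely_metrizable_bool)
qed


section \<open>Suslin trees\<close>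

text \<open>Trees are given by reflexive partial orders \<open>r\<close> on their set of nodes \<open>T\<close>.\<close>

definition tree_order :: "'a set \<Rightarrow> 'a rel \<Rightarrow> bool"
  where "tree_order T r \<longleftrightarrow> partial_order_on T r \<and>
    (\<forall>t\<in>T. well_order_on (underS r t) (Restr r (underS r t)))"

text \<open>The order relation of the ordinal \<open>\<alpha>\<close>.\<close>

definition ordinal_rel :: "omega1 \<Rightarrow> omega1 rel"
  where "ordinal_rel \<alpha> = {(\<beta>, \<gamma>). \<beta> \<le> \<gamma> \<and> \<gamma> < \<alpha>}"

definition tree_level :: "'a set \<Rightarrow> 'a rel \<Rightarrow> omega1 \<Rightarrow> 'a set"
  where "tree_level T r \<alpha> = {t \<in> T. Restr r (underS r t) =o ordinal_rel \<alpha>}"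

text \<open>The height is the least ordinal \<open>\<alpha>\<close> such that the level \<open>\<alpha>\<close> is empty. It is \<open>\<omega>\<^sub>1\<close> iff every
  countable level is nonempty and every node has countable height.\<close>

definition height_omega1 :: "'a set \<Rightarrow> 'a rel \<Rightarrow> bool"
  where "height_omega1 T r \<longleftrightarrow>
    (\<forall>\<alpha>. tree_level T r \<alpha> \<noteq> {}) \<and> T = (\<Union>\<alpha>. tree_level T r \<alpha>)"

definition antichain_in :: "'a set \<Rightarrow> 'a rel \<Rightarrow> 'a set \<Rightarrow> bool"
  where "antichain_in T r W \<longleftrightarrow>
    W \<subseteq> T \<and> (\<forall>s\<in>W. \<forall>t\<in>W. s \<noteq> t \<longrightarrow> (s, t) \<notin> r \<and> (t, s) \<notin> r)"

text \<open>The levels of a Suslin tree are antichains, hence countable, so the tree has cardinality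
  \<open>\<aleph>\<^sub>1\<close> and is isomorphic to one whose set of nodes is a subset of \<open>omega1\<close>.\<close>

definition suslin_tree :: "'a set \<Rightarrow> 'a rel \<Rightarrow> bool"
  where "suslin_tree T r \<longleftrightarrow>
    tree_order T r \<and> height_omega1 T r \<and>
    (\<forall>C \<in> Chains r. countable C) \<and>
    (\<forall>W. antichain_in T r W \<longrightarrow> countable W)"

end

theory Submission
  imports Defs
begin

text \<open>The nodes are split into \<open>\<omega>\<^sub>1\<close> countably infinite levels in advance, and the order is constructed by
  recursion on the level. Suppose that the order on the nodes below level \<open>\<delta>\<close> is given. A real
  \<open>x \<in> 2\<^sup>\<omega>\<close> guides a walk up this countable tree: the nodes are offered one after the other, each of
  them infinitely often, and when a node above the current position is offered, the bit of \<open>x\<close> says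
  whether to move there. The walks from the countably many starting nodes, all guided by the same
  real, trace chains, and the nodes of level \<open>\<delta>\<close> are put on top of these chains. If \<open>x\<close> is outside
  a suitable meager set, every walk enters a given set \<open>W\<close> of nodes that is cofinal in the tree
  below \<open>\<delta>\<close> (\<open>generic_walk_hits\<close>). As the nodes of level at least a given \<open>\<beta> < \<delta>\<close> form such a set,
  generic walks also pass through all levels below \<open>\<delta>\<close>.

  The tree is Suslin if every cofinal set \<open>W\<close> of nodes is sealed at some level \<open>\<delta>\<close>, that is, every
  node of level \<open>\<delta>\<close> is above a node of \<open>W\<close> (\<open>suslin_treeI\<close>). For an antichain \<open>A\<close>, take the nodes
  that are above some element of \<open>A\<close> or not below any; for a chain \<open>C\<close>, the nodes that are not below
  any element of \<open>C\<close>. In both cases the sealing keeps \<open>A\<close> or \<open>C\<close> below level \<open>\<delta>\<close>.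

  The principle supplies the guiding reals (\<open>sealing\<close>). The map \<open>F\<close> sends \<open>f \<restriction> \<delta>\<close> to the meager set of
  reals for which some walk misses \<open>W\<close> or stays below some level, and level \<open>\<delta>\<close> is built with
  \<open>g(\<delta>)\<close>. Here \<open>F\<close> has to be chosen before \<open>g\<close>, whereas the tree order depends on \<open>g\<close>; therefore
  \<open>F\<close> reads the order, together with \<open>W\<close>, from \<open>f\<close>. Once the tree is complete, some \<open>f\<close> codes its
  true order and \<open>W\<close>. For club many \<open>\<delta>\<close>, the part \<open>f \<restriction> \<delta>\<close> codes them for the nodes below \<open>\<delta>\<close>, and
  \<open>W\<close> is cofinal there; for stationarily many \<open>\<delta>\<close>, the real \<open>g(\<delta>)\<close> is outside the meager set.
  Hence \<open>W\<close> is sealed at some \<open>\<delta>\<close>.\<close>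

section \<open>Closed unbounded sets\<close>

lemma strict_upper_bound_omega1:
  assumes "countable (X :: omega1 set)"
  shows "\<exists>\<beta>. \<forall>\<alpha>\<in>X. \<alpha> < \<beta>"
proof (rule ccontr)
  assume "\<nexists>\<beta>. \<forall>\<alpha>\<in>X. \<alpha> < \<beta>"
  then have "UNIV = (\<Union>\<alpha>\<in>X. {..<\<alpha>} \<union> {\<alpha>})"
    by (force simp: not_less le_less)
  moreover have "countable (\<Union>\<alpha>\<in>X. {..<\<alpha>} \<union> {\<alpha>})"
    using assms by (intro countable_UN countable_Un countable_lessThan_omega1) auto
  ultimately show False using uncountable_omega1 by simp
qed

text \<open>The bound \<open>\<alpha>\<^sub>0\<close> serves to exclude \<open>0\<close>, which is vacuously closed under \<open>\<phi>\<close>.\<close>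

lemma club_closure_points:
  fixes \<phi> :: "omega1 \<Rightarrow> omega1"
  shows "club {\<delta>. \<alpha>\<^sub>0 < \<delta> \<and> (\<forall>\<alpha><\<delta>. \<phi> \<alpha> < \<delta>)}" (is "club ?C")
  unfolding club_def
proof
  show "closed_omega1 ?C"
    unfolding closed_omega1_def
  proof (intro allI impI CollectI, elim conjE)
    fix \<delta> assume "{..<\<delta>} \<noteq> {}" and lim: "\<forall>\<gamma><\<delta>. \<exists>\<beta>\<in>?C. \<gamma> < \<beta> \<and> \<beta> < \<delta>"
    then obtain \<gamma> where "\<gamma> < \<delta>" by auto
    then have "\<alpha>\<^sub>0 < \<delta>" using lim by force
    moreover have "\<phi> \<alpha> < \<delta>" if "\<alpha> < \<delta>" for \<alpha>
    proof -
      have "\<exists>\<beta>\<in>?C. \<alpha> < \<beta> \<and> \<beta> < \<delta>" using lim that by blast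
      then show ?thesis by force
    qed
    ultimately show "\<alpha>\<^sub>0 < \<delta> \<and> (\<forall>\<alpha><\<delta>. \<phi> \<alpha> < \<delta>)" by blast
  qed
  show "unbounded_omega1 ?C"
    unfolding unbounded_omega1_def
  proof
    fix \<alpha>
    have "\<exists>\<beta>'. \<beta> < \<beta>' \<and> (\<forall>\<gamma>\<le>\<beta>. \<phi> \<gamma> < \<beta>')" for \<beta>
    proof -
      have "countable (insert \<beta> (\<phi> ` ({..<\<beta>} \<union> {\<beta>})))"
        by (intro countable_insert countable_image countable_Un countable_lessThan_omega1) simp
      from strict_upper_bound_omega1[OF this] show ?thesis by (auto simp: le_less)
    qed
    then obtain nxt where nxt: "\<beta> < nxt \<beta>" "\<gamma> \<le> \<beta> \<Longrightarrow> \<phi> \<gamma> < nxt \<beta>" for \<beta> \<gamma> by metis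
    define a where "a n = (nxt ^^ n) (max \<alpha> \<alpha>\<^sub>0)" for n
    have a_Suc: "a (Suc n) = nxt (a n)" for n by (simp add: a_def)
    have "countable (range a)" by simp
    from strict_upper_bound_omega1[OF this] have ex: "\<exists>\<delta>. \<forall>n. a n < \<delta>" by auto
    define \<delta> where "\<delta> = (LEAST \<delta>. \<forall>n. a n < \<delta>)"
    have above: "a n < \<delta>" for n
      using LeastI_ex[OF ex] by (simp add: \<delta>_def)
    have "\<exists>n. \<gamma> \<le> a n" if "\<gamma> < \<delta>" for \<gamma>
      using not_less_Least[OF that[unfolded \<delta>_def]] by (auto simp: not_less)
    then have "\<phi> \<gamma> < \<delta>" if "\<gamma> < \<delta>" for \<gamma>
      using that nxt(2) above by (metis a_Suc less_trans)
    moreover have "\<alpha> < \<delta>" "\<alpha>\<^sub>0 < \<delta>" using above[of 0] by (auto simp: a_def)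
    ultimately show "\<exists>\<beta>\<in>?C. \<alpha> < \<beta>" by blast
  qed
qed

section \<open>Generic walks\<close>

text \<open>Positions and offers are natural numbers, and \<open>k\<close> is offered at time \<open>k\<close>. In the application they are
  indices in an enumeration of nodes that takes every value infinitely often, which makes a separate
  schedule of offers superfluous.\<close>

primrec walk :: "(nat \<Rightarrow> nat \<Rightarrow> bool) \<Rightarrow> nat \<Rightarrow> (nat \<Rightarrow> bool) \<Rightarrow> nat \<Rightarrow> nat"
  where
    "walk Q i x 0 = i"
  | "walk Q i x (Suc k) = (if x k \<and> Q (walk Q i x k) k then k else walk Q i x k)"

lemma walk_cong: "(\<And>j. j < k \<Longrightarrow> x j = y j) \<Longrightarrow> walk Q i x k = walk Q i y k"
  by (induction k) auto

lemma walk_stays: "(\<And>j. n \<le> j \<Longrightarrow> j < k \<Longrightarrow> \<not> x j) \<Longrightarrow> n \<le> k \<Longrightarrow> walk Q i x k = walk Q i x n"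
proof (induction k)
  case (Suc k)
  then show ?case by (cases "n = Suc k") auto
qed simp

definition visits :: "(nat \<Rightarrow> nat \<Rightarrow> bool) \<Rightarrow> (nat \<Rightarrow> bool) \<Rightarrow> nat \<Rightarrow> bool list \<Rightarrow> bool"
  where "visits Q P i \<sigma> \<longleftrightarrow> (\<exists>k\<le>length \<sigma>. P (walk Q i (nth \<sigma>) k))"

text \<open>The second conjunct empties the tree unless the first one defines a nowhere dense set. So every \<open>Q\<close>
  and \<open>P\<close>, whether or not they come from a tree, yield a code of a nowhere dense set.\<close>

definition avoid_tree :: "(nat \<Rightarrow> nat \<Rightarrow> bool) \<Rightarrow> (nat \<Rightarrow> bool) \<Rightarrow> nat \<Rightarrow> bool list \<Rightarrow> bool"
  where "avoid_tree Q P i \<sigma> \<longleftrightarrow>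
    \<not> visits Q P i \<sigma> \<and> (\<forall>\<tau>. \<exists>\<tau>'. prefix \<tau> \<tau>' \<and> visits Q P i \<tau>')"

definition avoid_trees ::
    "(nat \<Rightarrow> nat \<Rightarrow> bool) \<Rightarrow> (nat \<Rightarrow> nat \<Rightarrow> bool) \<Rightarrow> nat \<Rightarrow> bool list \<Rightarrow> bool"
  where "avoid_trees Q D n = (case prod_decode n of (m, i) \<Rightarrow> avoid_tree Q (D m) i)"

lemma visits_prefix:
  assumes "visits Q P i \<sigma>" "prefix \<sigma> \<tau>"
  shows "visits Q P i \<tau>"
proof -
  obtain k where k: "k \<le> length \<sigma>" "P (walk Q i (nth \<sigma>) k)"
    using assms(1) by (auto simp: visits_def)
  have "walk Q i (nth \<sigma>) k = walk Q i (nth \<tau>) k"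
    using k(1) assms(2) by (intro walk_cong) (auto simp: prefix_def nth_append)
  then show ?thesis
    using k prefix_length_le[OF assms(2)] by (auto simp: visits_def intro!: exI[of _ k])
qed

lemma avoid_trees_in_nonM_A: "avoid_trees Q D \<in> nonM_A"
proof -
  have "bin_tree (avoid_tree Q P i)" for P i
    using visits_prefix by (fastforce simp: bin_tree_def avoid_tree_def)
  moreover have "\<exists>t. prefix s t \<and> \<not> avoid_tree Q P i t" for P i s
    by (auto simp: avoid_tree_def)
  ultimately show ?thesis by (auto simp: nonM_A_def avoid_trees_def split: prod.split)
qed

text \<open>Instructions \<open>\<tau>\<close> lead to some position \<open>j\<close>; by density, after time \<open>length \<tau>\<close> there is still an
  offer that is a target and to which the walk can jump from \<open>j\<close>. Thus the instructions that avoid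
  the target form a nowhere dense tree, and \<open>x\<close> is not a branch of it.\<close>

lemma generic_walk_hits:
  assumes generic: "(avoid_trees Q D, x) \<in> nonM_E"
    and dense: "\<And>j n. \<exists>k\<ge>n. Q j k \<and> D m k"
  shows "\<exists>k. D m (walk Q i x k)"
proof -
  have "\<exists>\<tau>'. prefix \<tau> \<tau>' \<and> visits Q (D m) i \<tau>'" for \<tau>
  proof -
    let ?n = "length \<tau>" and ?j = "walk Q i (nth \<tau>) (length \<tau>)"
    obtain k where k: "k \<ge> ?n" "Q ?j k" "D m k" using dense by blast
    \<comment> \<open>Reject everything until \<open>k\<close> is offered, and accept it.\<close>
    define y where "y j = (if j < ?n then \<tau> ! j else j = k)" for j
    define \<tau>' where "\<tau>' = map y [0..<Suc k]"
    have "take ?n \<tau>' = \<tau>"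
      by (rule nth_equalityI) (use k in \<open>auto simp: \<tau>'_def y_def simp del: upt_Suc\<close>)
    then have "prefix \<tau> \<tau>'" by (metis take_is_prefix)
    have "walk Q i y k = walk Q i y ?n"
      by (rule walk_stays) (use k in \<open>auto simp: y_def\<close>)
    also have "\<dots> = ?j" by (rule walk_cong) (simp add: y_def)
    finally have "walk Q i y (Suc k) = k" using k by (simp add: y_def)
    moreover have "walk Q i (nth \<tau>') (Suc k) = walk Q i y (Suc k)"
      by (rule walk_cong) (auto simp: \<tau>'_def simp del: upt_Suc)
    ultimately have "visits Q (D m) i \<tau>'"
      using k by (auto simp: visits_def \<tau>'_def intro!: exI[of _ "Suc k"] simp del: walk.simps)
    then show ?thesis using \<open>prefix \<tau> \<tau>'\<close> by blast
  qed
  then have tree: "avoid_trees Q D (prod_encode (m, i)) \<sigma> \<longleftrightarrow> \<not> visits Q (D m) i \<sigma>" for \<sigma>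
    by (simp add: avoid_trees_def avoid_tree_def)
  have "x \<notin> branches (avoid_trees Q D (prod_encode (m, i)))"
    using generic by (auto simp: nonM_E_def)
  then obtain l where "visits Q (D m) i (map x [0..<l])"
    by (auto simp: branches_def tree)
  then obtain k where "k \<le> l" "D m (walk Q i (nth (map x [0..<l])) k)"
    by (auto simp: visits_def)
  moreover have "walk Q i (nth (map x [0..<l])) k = walk Q i x k"
    using \<open>k \<le> l\<close> by (intro walk_cong) simp
  ultimately show ?thesis by auto
qed

text \<open>This is the Baire category theorem for \<open>2\<^sup>\<omega>\<close>: extend finite sequences step by step, leaving the
  \<open>n\<close>-th tree at step \<open>n\<close>.\<close>

lemma exists_generic:
  assumes "T \<in> nonM_A"
  shows "\<exists>x. (T, x) \<in> nonM_E"
proof -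
  have "\<forall>n s. \<exists>t. prefix s t \<and> \<not> T n t" using assms by (auto simp: nonM_A_def)
  then obtain ext where "\<forall>n s. prefix s (ext n s) \<and> \<not> T n (ext n s)"
    unfolding choice_iff by blast
  then have ext: "prefix s (ext n s)" "\<not> T n (ext n s)" for n s by auto
  define \<sigma> where "\<sigma> = rec_nat [] ext"
  have Suc: "\<sigma> (Suc n) = ext n (\<sigma> n)" for n by (simp add: \<sigma>_def)
  have mono: "prefix (\<sigma> n) (\<sigma> m)" if "n \<le> m" for n m
    using that by (induction rule: dec_induct) (auto simp: Suc intro: ext(1) prefix_order.trans)
  define x where "x j \<longleftrightarrow> (\<exists>n. j < length (\<sigma> n) \<and> \<sigma> n ! j)" for j
  have agree: "\<sigma> n ! j = \<sigma> m ! j" if "j < length (\<sigma> n)" "j < length (\<sigma> m)" for n m j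
    using mono[of n m] mono[of m n] that by (cases "n \<le> m") (auto simp: prefix_def nth_append)
  have "x j = \<sigma> n ! j" if "j < length (\<sigma> n)" for n j
    unfolding x_def using that agree by blast
  then have x: "map x [0..<length (\<sigma> n)] = \<sigma> n" for n
    by (intro nth_equalityI) auto
  have "x \<notin> branches (T n)" for n
    using ext(2)[of n "\<sigma> n"] x[of "Suc n"] by (auto simp: branches_def Suc) metis
  then show ?thesis using assms by (auto simp: nonM_E_def nonM_B_def)
qed

section \<open>Borel dependence on the coded data\<close>

lemma measurable_walk:
  assumes [measurable]: "\<And>j k. Measurable.pred M (\<lambda>s. Q s j k)"
  shows "(\<lambda>s. walk (Q s) i x k) \<in> M \<rightarrow>\<^sub>M count_space UNIV"
proof (induction k)
  case (Suc k)
  note [measurable] = Suc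
  show ?case by simp measurable
qed simp

lemma measurable_avoid_trees:
  assumes Q: "\<And>j k. Measurable.pred M (\<lambda>s. Q s j k)"
    and [measurable]: "\<And>m j. Measurable.pred M (\<lambda>s. D s m j)"
  shows "(\<lambda>s. avoid_trees (Q s) (D s)) \<in> M \<rightarrow>\<^sub>M restrict_space borel nonM_A"
proof (rule measurable_restrict_space2)
  note [measurable] = measurable_walk[OF Q]
  show "(\<lambda>s. avoid_trees (Q s) (D s)) \<in> borel_measurable M"
  proof (intro measurable_coordinatewise_then_product)
    fix n \<sigma>
    obtain m i where n: "prod_decode n = (m, i)" by force
    have "Measurable.pred M (\<lambda>s. avoid_trees (Q s) (D s) n \<sigma>)"
      unfolding avoid_trees_def n prod.case avoid_tree_def visits_def by measurable
    then show "(\<lambda>s. avoid_trees (Q s) (D s) n \<sigma>) \<in> borel_measurable M"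
      by (simp add: measurable_cong_sets[OF refl sets_borel_eq_count_space])
  qed
qed (simp add: avoid_trees_in_nonM_A)

text \<open>At coordinates \<open>\<beta> \<ge> \<delta>\<close> the evaluation is constant, since the elements of \<open>2\<^sup>\<delta>\<close> are extensional.\<close>

lemma measurable_two_pow_coordinate:
  "Measurable.pred (borel_of_topology (two_pow \<delta>)) (\<lambda>s. s \<beta>)"
proof -
  let ?X = "two_pow \<delta>"
  have sets: "U \<in> sets (borel_of_topology ?X)" if "openin ?X U" for U
    unfolding borel_of_topology_def
    using that openin_subset by (subst sets_measure_of) (auto intro: sigma_sets.Basic)
  have space: "space (borel_of_topology ?X) = topspace ?X"
    unfolding borel_of_topology_def by (rule space_measure_of) (auto dest: openin_subset)
  have "openin ?X {s \<in> topspace ?X. s \<beta>}"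
  proof (cases "\<beta> < \<delta>")
    case True
    then have "continuous_map ?X (discrete_topology UNIV) (\<lambda>s. s \<beta>)"
      unfolding two_pow_def by (intro continuous_map_product_projection) simp
    from openin_continuous_map_preimage[OF this, of "{True}"] show ?thesis by simp
  next
    case False
    then have "s \<beta> = undefined" if "s \<in> topspace ?X" for s
      using that by (auto simp: two_pow_def PiE_def extensional_def)
    then have "{s \<in> topspace ?X. s \<beta>} = (if undefined then topspace ?X else {})" by auto
    then show ?thesis by simp
  qed
  then show ?thesis by (auto simp: pred_def space intro: sets)
qed

section \<open>Trees with a level function\<close>

lemma ordinal_rel_Well_order: "Well_order (ordinal_rel \<alpha>)" "Field (ordinal_rel \<alpha>) = {..<\<alpha>}"
proof -
  show F: "Field (ordinal_rel \<alpha>) = {..<\<alpha>}"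
    by (auto simp: ordinal_rel_def Field_def)
  have "wf (ordinal_rel \<alpha> - Id)"
    by (rule wf_subset[OF wf]) (auto simp: ordinal_rel_def)
  then show "Well_order (ordinal_rel \<alpha>)"
    unfolding F order_on_defs
    by (auto simp: ordinal_rel_def refl_on_def trans_def antisym_def total_on_def)
qed

lemma ordinal_rel_ordIso_iff: "ordinal_rel \<alpha> =o ordinal_rel \<beta> \<longleftrightarrow> \<alpha> = \<beta>"
proof -
  have less: "ordinal_rel \<alpha> <o ordinal_rel \<beta>" if "\<alpha> < \<beta>" for \<alpha> \<beta>
  proof -
    have "ordinal_rel \<alpha> = Restr (ordinal_rel \<beta>) (underS (ordinal_rel \<beta>) \<alpha>)"
      using that by (auto simp: ordinal_rel_def underS_def)
    then show ?thesis
      using underS_Restr_ordLess[OF ordinal_rel_Well_order(1), of \<beta> \<alpha>] that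
      by (auto simp: ordinal_rel_Well_order)
  qed
  show ?thesis
    using less[of \<alpha> \<beta>] less[of \<beta> \<alpha>] ordinal_rel_Well_order(1)
    by (metis linorder_neqE not_ordLess_ordIso ordIso_reflexive ordIso_symmetric)
qed

text \<open>The function \<open>preds\<close> gives the strict predecessors of a node. Since they contain exactly one node of
  each smaller level, \<open>lev\<close> is the height function of the tree.\<close>

locale leveled_tree =
  fixes lev :: "'a \<Rightarrow> omega1" and preds :: "'a \<Rightarrow> 'a set"
  assumes countable_below: "countable {u. lev u < \<delta>}"
    and lev_preds: "u \<in> preds v \<Longrightarrow> lev u < lev v"
    and preds_trans: "u \<in> preds v \<Longrightarrow> v \<in> preds w \<Longrightarrow> u \<in> preds w"
    and preds_linear: "u \<in> preds w \<Longrightarrow> v \<in> preds w \<Longrightarrow> u = v \<or> u \<in> preds v \<or> v \<in> preds u"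
    and preds_level: "\<beta> < lev w \<Longrightarrow> \<exists>u\<in>preds w. lev u = \<beta>"
begin

lemma preds_asym: "u \<in> preds v \<Longrightarrow> v \<notin> preds u"
  using lev_preds by (meson less_asym)

definition tree_rel :: "'a rel"
  where "tree_rel = {(u, v). u = v \<or> u \<in> preds v}"

lemma underS_tree_rel: "underS tree_rel t = preds t"
  using preds_asym by (auto simp: underS_def tree_rel_def)

lemma dir_image_preds: "dir_image (Restr tree_rel (preds t)) lev = ordinal_rel (lev t)"
proof (intro set_eqI iffI; clarify)
  fix \<beta> \<gamma> assume "(\<beta>, \<gamma>) \<in> dir_image (Restr tree_rel (preds t)) lev"
  then show "(\<beta>, \<gamma>) \<in> ordinal_rel (lev t)"
    using lev_preds by (fastforce simp: dir_image_def ordinal_rel_def tree_rel_def)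
next
  fix \<beta> \<gamma> assume "(\<beta>, \<gamma>) \<in> ordinal_rel (lev t)"
  then have le: "\<beta> \<le> \<gamma>" "\<beta> < lev t" "\<gamma> < lev t" by (auto simp: ordinal_rel_def)
  obtain u v where uv: "u \<in> preds t" "lev u = \<beta>" "v \<in> preds t" "lev v = \<gamma>"
    using preds_level le by meson
  have "(u, v) \<in> tree_rel"
    using preds_linear[OF uv(1,3)] lev_preds[of v u] uv le by (auto simp: tree_rel_def)
  then show "(\<beta>, \<gamma>) \<in> dir_image (Restr tree_rel (preds t)) lev"
    using uv by (auto simp: dir_image_def)
qed

lemma Field_preds: "Field (Restr tree_rel (preds t)) = preds t"
  by (auto simp: Field_def tree_rel_def)

lemma tree_order_tree_rel: "tree_order UNIV tree_rel"
  unfolding tree_order_def underS_tree_rel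
proof (intro conjI ballI)
  have "antisym tree_rel"
    using preds_asym by (auto simp: antisym_def tree_rel_def)
  then show "partial_order_on UNIV tree_rel"
    using preds_trans by (auto simp: order_on_defs refl_on_def trans_def tree_rel_def)
  fix t
  have "wf (Restr tree_rel (preds t) - Id)"
    by (rule wf_subset[OF wf_inv_image[OF wf, of lev]])
      (auto simp: inv_image_def tree_rel_def lev_preds)
  then show "well_order_on (preds t) (Restr tree_rel (preds t))"
    unfolding order_on_defs
  proof (intro conjI)
    show "trans (Restr tree_rel (preds t))"
      using \<open>partial_order_on UNIV tree_rel\<close>
      by (auto simp: order_on_defs intro: trans_Restr)
    show "antisym (Restr tree_rel (preds t))"
      using \<open>partial_order_on UNIV tree_rel\<close>
      by (auto simp: order_on_defs intro: antisym_subset)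
    show "total_on (preds t) (Restr tree_rel (preds t))"
      unfolding total_on_def using preds_linear by (auto simp: tree_rel_def)
  qed (auto simp: refl_on_def tree_rel_def)
qed

text \<open>By \<open>dir_image_preds\<close> the level function is an isomorphism from the predecessors of \<open>t\<close> to
  \<open>{..<lev t}\<close>, and distinct ordinals are not isomorphic.\<close>

lemma tree_level_tree_rel: "tree_level UNIV tree_rel \<alpha> = {t. lev t = \<alpha>}"
proof -
  have "Restr tree_rel (preds t) =o ordinal_rel (lev t)" for t
  proof -
    have "Well_order (Restr tree_rel (preds t))"
      using tree_order_tree_rel unfolding tree_order_def underS_tree_rel Field_preds by blast
    moreover have "inj_on lev (preds t)"
      using preds_linear lev_preds by (fastforce simp: inj_on_def)
    ultimately show ?thesis
      using dir_image_ordIso[of "Restr tree_rel (preds t)" lev]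
      by (simp add: Field_preds dir_image_preds)
  qed
  then have "Restr tree_rel (preds t) =o ordinal_rel \<alpha> \<longleftrightarrow> lev t = \<alpha>" for t
    using ordinal_rel_ordIso_iff by (metis ordIso_transitive ordIso_symmetric)
  then show ?thesis
    unfolding tree_level_def underS_tree_rel by simp
qed

definition cofinal_nodes :: "'a set \<Rightarrow> bool"
  where "cofinal_nodes W \<longleftrightarrow> (\<forall>t. \<exists>w\<in>W. (t, w) \<in> tree_rel)"

text \<open>Sealing \<open>W\<close> at \<open>\<delta>\<close> puts an element of \<open>W\<close> below every node of level at least \<open>\<delta>\<close>, so \<open>W\<close> is chosen
  such that the elements of the given chain or antichain have no predecessors in \<open>W\<close>. Splitting makes
  the choice for a chain cofinal: of two nodes on the same level above \<open>t\<close>, at most one is below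
  elements of the chain.\<close>

lemma suslin_treeI:
  assumes levels: "\<And>\<alpha>. \<exists>t. lev t = \<alpha>"
    and splitting: "\<And>t. \<exists>v w. t \<in> preds v \<and> t \<in> preds w \<and> lev v = lev w \<and> v \<noteq> w"
    and sealing: "\<And>W. cofinal_nodes W \<Longrightarrow> \<exists>\<delta>. \<forall>v. lev v = \<delta> \<longrightarrow> preds v \<inter> W \<noteq> {}"
  shows "suslin_tree UNIV tree_rel"
proof -
  have above: "\<exists>\<delta>. \<forall>v. \<delta> \<le> lev v \<longrightarrow> preds v \<inter> W \<noteq> {}" if W: "cofinal_nodes W" for W
  proof -
    obtain \<delta> where \<delta>: "\<And>v. lev v = \<delta> \<Longrightarrow> preds v \<inter> W \<noteq> {}" using sealing[OF W] by blast
    have "preds v \<inter> W \<noteq> {}" if "\<delta> \<le> lev v" for v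
    proof (cases "lev v = \<delta>")
      case False
      then have "\<delta> < lev v" using that by simp
      then obtain u where "u \<in> preds v" "lev u = \<delta>" using preds_level by blast
      then show ?thesis using \<delta>[of u] preds_trans by blast
    qed (use \<delta> in blast)
    then show ?thesis by blast
  qed
  have "countable C" if C: "C \<in> Chains tree_rel" for C
  proof -
    define W where "W = {w. \<forall>c\<in>C. (w, c) \<notin> tree_rel}"
    have "cofinal_nodes W"
      unfolding cofinal_nodes_def
    proof
      fix t
      obtain v w where vw: "t \<in> preds v" "t \<in> preds w" "lev v = lev w" "v \<noteq> w"
        using splitting by blast
      have "v \<in> W \<or> w \<in> W"
      proof (rule ccontr)
        assume "\<not> ?thesis"
        then obtain c d where cd: "c \<in> C" "d \<in> C" "(v, c) \<in> tree_rel" "(w, d) \<in> tree_rel"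
          by (auto simp: W_def)
        then have "(c, d) \<in> tree_rel \<or> (d, c) \<in> tree_rel"
          using C by (auto simp: Chains_def)
        then obtain e where "(v, e) \<in> tree_rel" "(w, e) \<in> tree_rel"
          using cd preds_trans by (auto simp: tree_rel_def)
        then show False
          using vw(3,4) preds_linear[of v e w] lev_preds[of v w] lev_preds[of w v]
          by (auto simp: tree_rel_def)
      qed
      then show "\<exists>w\<in>W. (t, w) \<in> tree_rel" using vw by (auto simp: tree_rel_def)
    qed
    then obtain \<delta> where \<delta>: "\<And>v. \<delta> \<le> lev v \<Longrightarrow> preds v \<inter> W \<noteq> {}" using above by blast
    have "C \<subseteq> {u. lev u < \<delta>}"
      using \<delta> by (force simp: W_def tree_rel_def not_le[symmetric])
    then show ?thesis using countable_below countable_subset by blast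
  qed
  moreover have "countable A" if A: "antichain_in UNIV tree_rel A" for A
  proof -
    define W where "W = {w. (\<exists>a\<in>A. (a, w) \<in> tree_rel) \<or> (\<forall>a\<in>A. (w, a) \<notin> tree_rel)}"
    have "cofinal_nodes W"
      unfolding cofinal_nodes_def
    proof
      fix t
      show "\<exists>w\<in>W. (t, w) \<in> tree_rel"
      proof (cases "\<exists>a\<in>A. (t, a) \<in> tree_rel")
        case True
        then show ?thesis by (auto simp: W_def tree_rel_def)
      next
        case False
        then show ?thesis by (intro bexI[of _ t]) (auto simp: W_def tree_rel_def)
      qed
    qed
    then obtain \<delta> where \<delta>: "\<And>v. \<delta> \<le> lev v \<Longrightarrow> preds v \<inter> W \<noteq> {}" using above by blast
    have "lev b < \<delta>" if b: "b \<in> A" for b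
    proof (rule ccontr)
      assume "\<not> ?thesis"
      then have "preds b \<inter> W \<noteq> {}" by (intro \<delta>) simp
      then obtain w where w: "w \<in> W" "w \<in> preds b" by blast
      then obtain a where a: "a \<in> A" "(a, w) \<in> tree_rel"
        using b by (auto simp: W_def tree_rel_def)
      then have "a \<in> preds b" using w preds_trans by (auto simp: tree_rel_def)
      then show False
        using A a(1) b preds_asym[of a b] by (auto simp: antichain_in_def tree_rel_def)
    qed
    then have "A \<subseteq> {u. lev u < \<delta>}" by blast
    then show ?thesis using countable_below countable_subset by blast
  qed
  moreover have "height_omega1 UNIV tree_rel"
    using levels by (auto simp: height_omega1_def tree_level_tree_rel)
  ultimately show ?thesis
    using tree_order_tree_rel by (simp add: suslin_tree_def)
qed

end

section \<open>Coding the order and a set of nodes\<close>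

locale node_coding =
  fixes lev :: "'a \<Rightarrow> omega1" and idx :: "'a \<Rightarrow> nat" and code :: "'a \<times> 'a \<times> bool \<Rightarrow> omega1"
  assumes bij_lev_idx: "bij (\<lambda>u. (lev u, idx u))" and inj_code: "inj code"
begin

lemma countable_below: "countable {u. lev u < \<delta>}"
proof (rule countable_image_inj_on)
  have "countable ({..<\<delta>} \<times> (UNIV :: nat set))"
    by (intro countable_SIGMA countable_lessThan_omega1) simp
  then show "countable ((\<lambda>u. (lev u, idx u)) ` {u. lev u < \<delta>})"
    by (rule countable_subset[rotated]) auto
  show "inj_on (\<lambda>u. (lev u, idx u)) {u. lev u < \<delta>}"
    using bij_lev_idx by (auto simp: bij_def intro: inj_on_subset)
qed

lemma exists_node: "\<exists>u. lev u = \<alpha> \<and> idx u = n"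
  using bij_lev_idx unfolding bij_def surj_def by (metis prod.inject)

definition enum :: "omega1 \<Rightarrow> nat \<Rightarrow> 'a"
  where "enum \<delta> k = from_nat_into {u. lev u < \<delta>} (fst (prod_decode k))"

lemma lev_enum: "\<alpha> < \<delta> \<Longrightarrow> lev (enum \<delta> k) < \<delta>"
  unfolding enum_def using from_nat_into[of "{u. lev u < \<delta>}"] exists_node
  by (metis (mono_tags) empty_Collect_eq mem_Collect_eq)

lemma enum_infinitely_often:
  assumes "lev u < \<delta>"
  shows "\<exists>k\<ge>n. enum \<delta> k = u"
proof -
  obtain i where "from_nat_into {u. lev u < \<delta>} i = u"
    using from_nat_into_surj[OF countable_below] assms by blast
  then have "enum \<delta> (prod_encode (i, n)) = u" by (simp add: enum_def)
  then show ?thesis using le_prod_encode_2 by blast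
qed

text \<open>Target \<open>0\<close> is the set to be sealed. The others make the walk pass through all levels below \<open>\<delta>\<close>,
  since every such level is the level of some \<open>enum \<delta> m\<close>.\<close>

definition targets :: "omega1 \<Rightarrow> (nat \<Rightarrow> bool) \<Rightarrow> nat \<Rightarrow> nat \<Rightarrow> bool"
  where "targets \<delta> P m j =
    (case m of 0 \<Rightarrow> P j | Suc m \<Rightarrow> lev (enum \<delta> m) \<le> lev (enum \<delta> j))"

text \<open>This is the map \<open>F\<close> to which the principle is applied: the value of \<open>s\<close> at \<open>code (u, v, True)\<close> tells
  whether \<open>u \<le> v\<close>, and the value at \<open>code (u, u, False)\<close> whether \<open>u \<in> W\<close>.\<close>

definition avoid_guess :: "omega1 \<times> (omega1 \<Rightarrow> bool) \<Rightarrow> nat \<Rightarrow> bool list \<Rightarrow> bool"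
  where "avoid_guess = (\<lambda>(\<delta>, s).
    avoid_trees (\<lambda>j k. s (code (enum \<delta> j, enum \<delta> k, True)))
      (targets \<delta> (\<lambda>j. s (code (enum \<delta> j, enum \<delta> j, False)))))"

lemma borel_map_avoid_guess: "borel_map avoid_guess nonM_A"
  unfolding borel_map_def avoid_guess_def prod.case
proof (intro allI measurable_avoid_trees measurable_two_pow_coordinate)
  fix \<delta> m j
  show "Measurable.pred (borel_of_topology (two_pow \<delta>))
    (\<lambda>s. targets \<delta> (\<lambda>j. s (code (enum \<delta> j, enum \<delta> j, False))) m j)"
    by (cases m) (simp_all add: targets_def measurable_two_pow_coordinate)
qed

end

section \<open>Construction of the tree\<close>

locale tree_construction = node_coding lev idx code
  for lev :: "'a \<Rightarrow> omega1" and idx code +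
  fixes g :: "omega1 \<Rightarrow> nat \<Rightarrow> bool"
begin

text \<open>The function \<open>b\<close> stands for the strict predecessors constructed so far; only its values at nodes of
  smaller level will matter (\<open>preds_step_cong\<close>).\<close>

definition below :: "('a \<Rightarrow> 'a set) \<Rightarrow> 'a \<Rightarrow> 'a \<Rightarrow> bool"
  where "below b u v \<longleftrightarrow> u = v \<or> u \<in> b v"

definition enum_below :: "('a \<Rightarrow> 'a set) \<Rightarrow> omega1 \<Rightarrow> nat \<Rightarrow> nat \<Rightarrow> bool"
  where "enum_below b \<delta> j k \<longleftrightarrow> below b (enum \<delta> j) (enum \<delta> k)"

definition climbs :: "('a \<Rightarrow> 'a set) \<Rightarrow> omega1 \<Rightarrow> (nat \<Rightarrow> bool) \<Rightarrow> bool"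
  where "climbs b \<delta> x \<longleftrightarrow>
    (\<forall>i. \<forall>\<beta><\<delta>. \<exists>k. \<beta> \<le> lev (enum \<delta> (walk (enum_below b \<delta>) i x k)))"

text \<open>Where the data coded by \<open>f\<close> are not those of the tree, \<open>g \<delta>\<close> may leave a walk stuck below some level.
  The choice of another climbing real does no harm there, as nothing has to be sealed.\<close>

definition guide :: "('a \<Rightarrow> 'a set) \<Rightarrow> omega1 \<Rightarrow> nat \<Rightarrow> bool"
  where "guide b \<delta> = (if climbs b \<delta> (g \<delta>) then g \<delta> else SOME x. climbs b \<delta> x)"

definition path :: "('a \<Rightarrow> 'a set) \<Rightarrow> 'a \<Rightarrow> nat \<Rightarrow> 'a"
  where "path b v k = enum (lev v) (walk (enum_below b (lev v)) (idx v) (guide b (lev v)) k)"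

text \<open>The condition on levels makes the nodes of level \<open>0\<close> minimal: no node can be enumerated below them,
  so their paths consist of arbitrary nodes.\<close>

definition preds_step :: "('a \<Rightarrow> 'a set) \<Rightarrow> 'a \<Rightarrow> 'a set"
  where "preds_step b v = {u. lev u < lev v \<and> (\<exists>k. below b u (path b v k))}"

definition preds :: "'a \<Rightarrow> 'a set"
  where "preds = wfrec (inv_image {(\<alpha>, \<beta>). \<alpha> < \<beta>} lev) preds_step"

lemma preds_step_cong:
  assumes "\<And>u. lev u < lev v \<Longrightarrow> b u = c u"
  shows "preds_step b v = preds_step c v"
proof (cases "\<exists>\<alpha>. \<alpha> < lev v")
  case True
  then have lev: "lev (enum (lev v) k) < lev v" for k using lev_enum by blast
  have eq: "enum_below b (lev v) = enum_below c (lev v)"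
    using assms lev by (auto simp: enum_below_def below_def fun_eq_iff)
  then have "climbs b (lev v) = climbs c (lev v)"
    by (simp add: climbs_def[abs_def])
  then have "path b v = path c v"
    using eq by (simp add: path_def[abs_def] guide_def)
  moreover have "b (path c v k) = c (path c v k)" for k
    using assms lev by (simp add: path_def)
  ultimately show ?thesis by (auto simp: preds_step_def below_def)
qed (auto simp: preds_step_def)

lemma preds_eq: "preds v = {u. lev u < lev v \<and> (\<exists>k. below preds u (path preds v k))}"
proof -
  have "preds v = preds_step preds v"
    unfolding preds_def
    by (subst wfrec[OF wf_inv_image[OF wf]], rule preds_step_cong) (simp add: cut_def)
  then show ?thesis by (simp add: preds_step_def)
qed

abbreviation le_node :: "'a \<Rightarrow> 'a \<Rightarrow> bool"
  where "le_node \<equiv> below preds"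

lemma lev_preds: "u \<in> preds v \<Longrightarrow> lev u < lev v"
  by (subst (asm) preds_eq) simp

lemma lev_path: "\<alpha> < lev v \<Longrightarrow> lev (path preds v k) < lev v"
  unfolding path_def by (rule lev_enum)

lemma path_in_preds: "\<alpha> < lev v \<Longrightarrow> path preds v k \<in> preds v"
  by (subst preds_eq) (auto simp: lev_path below_def)

text \<open>The predecessors of \<open>w\<close> are the nodes below the positions on its path, which have smaller level. This
  reduces transitivity and linearity at \<open>w\<close> to nodes of smaller level.\<close>

lemma preds_trans: "u \<in> preds v \<Longrightarrow> v \<in> preds w \<Longrightarrow> u \<in> preds w"
proof (induction "lev w" arbitrary: u v w rule: less_induct)
  case less
  have lev: "lev u < lev w" "lev v < lev w"
    using less.prems lev_preds by (auto intro: less_trans)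
  obtain k where k: "le_node v (path preds w k)"
    using less.prems(2) by (subst (asm) preds_eq) auto
  have "le_node u (path preds w k)"
    using k less.prems(1) less.hyps[OF lev_path[OF lev(1)]] by (auto simp: below_def)
  then show ?case using lev by (subst preds_eq) auto
qed

lemma le_node_trans: "le_node u v \<Longrightarrow> le_node v w \<Longrightarrow> le_node u w"
  using preds_trans by (auto simp: below_def)

lemma path_mono: "k \<le> l \<Longrightarrow> le_node (path preds v k) (path preds v l)"
proof (induction rule: dec_induct)
  case (step l)
  have "le_node (path preds v l) (path preds v (Suc l))"
    by (auto simp: path_def enum_below_def below_def)
  then show ?case using step le_node_trans by blast
qed (simp add: below_def)

lemma preds_linear: "u \<in> preds w \<Longrightarrow> v \<in> preds w \<Longrightarrow> u = v \<or> u \<in> preds v \<or> v \<in> preds u"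
proof (induction "lev w" arbitrary: u v w rule: less_induct)
  case less
  have lev: "lev u < lev w" using less.prems lev_preds by auto
  obtain k l where kl: "le_node u (path preds w k)" "le_node v (path preds w l)"
    using less.prems by (subst (asm) (1 2) preds_eq) auto
  let ?p = "path preds w (max k l)"
  have "le_node u ?p" "le_node v ?p"
    using kl le_node_trans path_mono[of _ "max k l" w] by (meson max.cobounded1 max.cobounded2)+
  then show ?case using less.hyps[OF lev_path[OF lev]] by (auto simp: below_def)
qed

text \<open>Every node occurs infinitely often in the enumeration, so it is the start of the paths of infinitely
  many nodes of level \<open>\<delta>\<close>. In particular the tree splits above it.\<close>

lemma exists_extension:
  assumes "lev u < \<delta>"
  shows "\<exists>v w. u \<in> preds v \<and> u \<in> preds w \<and> lev v = \<delta> \<and> lev w = \<delta> \<and> v \<noteq> w"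
proof -
  obtain i where i: "enum \<delta> i = u" using enum_infinitely_often[OF assms] by blast
  obtain j where j: "j \<ge> Suc i" "enum \<delta> j = u" using enum_infinitely_often[OF assms] by blast
  obtain v w where vw: "lev v = \<delta>" "idx v = i" "lev w = \<delta>" "idx w = j"
    using exists_node by meson
  have "path preds v 0 = u" "path preds w 0 = u" using i j vw by (auto simp: path_def)
  then have "u \<in> preds v" "u \<in> preds w" using path_in_preds assms vw by metis+
  moreover have "v \<noteq> w" using vw j by auto
  ultimately show ?thesis using vw by blast
qed

lemma targets_dense:
  assumes "\<And>j. \<exists>w. lev w < \<delta> \<and> le_node (enum \<delta> j) w \<and> P w"
    and \<alpha>: "\<alpha> < \<delta>"
  shows "\<exists>k\<ge>n. enum_below preds \<delta> j k \<and> targets \<delta> (\<lambda>j. P (enum \<delta> j)) m k"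
proof -
  have "\<exists>w. lev w < \<delta> \<and> le_node (enum \<delta> j) w \<and>
    (case m of 0 \<Rightarrow> P w | Suc m \<Rightarrow> lev (enum \<delta> m) \<le> lev w)"
  proof (cases m)
    case (Suc m')
    show ?thesis
    proof (cases "lev (enum \<delta> j) < lev (enum \<delta> m')")
      case True
      then obtain v where "enum \<delta> j \<in> preds v" "lev v = lev (enum \<delta> m')"
        using exists_extension by blast
      then show ?thesis
        using lev_enum[OF \<alpha>] Suc by (intro exI[of _ v]) (auto simp: below_def)
    next
      case False
      then show ?thesis
        using lev_enum[OF \<alpha>] Suc by (intro exI[of _ "enum \<delta> j"]) (auto simp: below_def)
    qed
  qed (use assms(1) in simp)
  then obtain w where w: "lev w < \<delta>" "le_node (enum \<delta> j) w"
    "case m of 0 \<Rightarrow> P w | Suc m \<Rightarrow> lev (enum \<delta> m) \<le> lev w" by blast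
  obtain k where "k \<ge> n" "enum \<delta> k = w" using enum_infinitely_often[OF w(1)] by blast
  then show ?thesis using w(2,3) by (auto simp: enum_below_def targets_def split: nat.splits)
qed

lemma generic_climbs:
  assumes generic: "(avoid_trees (enum_below preds \<delta>) (targets \<delta> (\<lambda>j. P (enum \<delta> j))), x) \<in> nonM_E"
    and dense: "\<And>j. \<exists>w. lev w < \<delta> \<and> le_node (enum \<delta> j) w \<and> P w"
  shows "climbs preds \<delta> x"
  unfolding climbs_def
proof (intro allI impI)
  fix i \<beta> assume \<beta>: "\<beta> < \<delta>"
  obtain u where u: "lev u = \<beta>" using exists_node by blast
  then obtain m where "enum \<delta> m = u" using \<beta> enum_infinitely_often by blast
  then show "\<exists>k. \<beta> \<le> lev (enum \<delta> (walk (enum_below preds \<delta>) i x k))"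
    using generic_walk_hits[OF generic targets_dense[OF dense \<beta>], of "Suc m" i] u
    by (simp add: targets_def)
qed

text \<open>The fallback in \<open>guide\<close> exists by the Baire category theorem, with the set of all nodes in place of
  the set to be sealed.\<close>

lemma guide_climbs: "climbs preds \<delta> (guide preds \<delta>)"
proof -
  have "\<exists>x. climbs preds \<delta> x"
  proof (cases "\<exists>\<alpha>. \<alpha> < \<delta>")
    case True
    then have "\<exists>w. lev w < \<delta> \<and> le_node (enum \<delta> j) w \<and> True" for j
      using lev_enum by (auto simp: below_def)
    then show ?thesis
      using exists_generic[OF avoid_trees_in_nonM_A] generic_climbs[where P = "\<lambda>_. True"] by blast
  qed (auto simp: climbs_def)
  from someI_ex[OF this] show ?thesis by (simp add: guide_def)
qed

lemma preds_level: "\<beta> < lev w \<Longrightarrow> \<exists>u\<in>preds w. lev u = \<beta>"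
proof (induction "lev w" arbitrary: w rule: less_induct)
  case less
  obtain k where k: "\<beta> \<le> lev (path preds w k)"
    using guide_climbs[of "lev w"] less.prems by (auto simp: climbs_def path_def)
  note p = path_in_preds[OF less.prems, of k]
  show ?case
  proof (cases "lev (path preds w k) = \<beta>")
    case False
    then show ?thesis
      using less.hyps[OF lev_path[OF less.prems, of k]] k p preds_trans by (metis le_less)
  qed (use p in blast)
qed

sublocale leveled_tree lev preds
  using countable_below lev_preds preds_trans preds_linear preds_level by unfold_locales

lemma tree_rel_iff: "(u, v) \<in> tree_rel \<longleftrightarrow> le_node u v"
  by (simp add: tree_rel_def below_def)

text \<open>At a closure point \<open>\<delta>\<close> of \<open>\<phi>\<close>, the restriction \<open>f \<restriction> \<delta>\<close> codes all of the order and of \<open>W\<close> on the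
  nodes below \<open>\<delta>\<close>, and each of these nodes has an extension in \<open>W\<close> below level \<open>\<delta>\<close>. The closure points
  form a club, so \<open>g \<delta>\<close> is generic at one of them; it then is the real that guided the walks to
  level \<open>\<delta>\<close>.\<close>

lemma sealing:
  assumes diamond: "\<And>f. stationary {\<delta>. (avoid_guess (seg f \<delta>), g \<delta>) \<in> nonM_E}"
    and W: "cofinal_nodes W"
  shows "\<exists>\<delta>. \<forall>v. lev v = \<delta> \<longrightarrow> preds v \<inter> W \<noteq> {}"
proof -
  obtain wit where wit: "wit t \<in> W" "le_node t (wit t)" for t
    using W unfolding cofinal_nodes_def tree_rel_iff by metis
  define f where "f = (\<lambda>(u, v, b). if b then le_node u v else u \<in> W) \<circ> inv code"
  have f: "f (code (u, v, True)) \<longleftrightarrow> le_node u v" "f (code (u, v, False)) \<longleftrightarrow> u \<in> W" for u v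
    by (simp_all add: f_def inj_code)
  have "\<exists>\<phi>. (\<forall>u v b. lev u \<le> \<beta> \<longrightarrow> lev v \<le> \<beta> \<longrightarrow> code (u, v, b) < \<phi>) \<and>
      (\<forall>u. lev u \<le> \<beta> \<longrightarrow> lev (wit u) < \<phi>)" for \<beta>
  proof -
    let ?N = "{u. lev u \<le> \<beta>}"
    obtain \<gamma> where "\<beta> < \<gamma>" using strict_upper_bound_omega1[of "{\<beta>}"] by auto
    then have N: "countable ?N" by (intro countable_subset[OF _ countable_below[of \<gamma>]]) auto
    have "countable (code ` (?N \<times> ?N \<times> UNIV) \<union> (lev \<circ> wit) ` ?N)"
      by (intro countable_Un countable_image countable_SIGMA N) auto
    from strict_upper_bound_omega1[OF this] show ?thesis by auto
  qed
  then obtain \<phi> where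
    \<phi>: "\<And>\<beta> u v b. lev u \<le> \<beta> \<Longrightarrow> lev v \<le> \<beta> \<Longrightarrow> code (u, v, b) < \<phi> \<beta>"
      "\<And>\<beta> u. lev u \<le> \<beta> \<Longrightarrow> lev (wit u) < \<phi> \<beta>"
    by metis
  \<comment> \<open>Any ordinal will do: it only keeps \<open>\<delta>\<close> from being \<open>0\<close>, below which there are no nodes.\<close>
  obtain \<alpha>\<^sub>0 :: omega1 where True by simp
  obtain \<delta> where \<delta>: "\<alpha>\<^sub>0 < \<delta>" "\<And>\<alpha>. \<alpha> < \<delta> \<Longrightarrow> \<phi> \<alpha> < \<delta>"
    and generic: "(avoid_guess (seg f \<delta>), g \<delta>) \<in> nonM_E"
    using diamond[of f] club_closure_points[of \<alpha>\<^sub>0 \<phi>] unfolding stationary_def by blast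
  note lev = lev_enum[OF \<delta>(1)]
  have "code (u, v, b) < \<delta>" if "lev u < \<delta>" "lev v < \<delta>" for u v b
    using \<phi>(1)[of u "max (lev u) (lev v)" v b] \<delta>(2)[of "max (lev u) (lev v)"] that
    by (auto intro: less_trans)
  then have "avoid_guess (seg f \<delta>) =
      avoid_trees (enum_below preds \<delta>) (targets \<delta> (\<lambda>j. enum \<delta> j \<in> W))"
    using lev by (simp add: avoid_guess_def seg_def f enum_below_def[abs_def])
  then have generic: "(avoid_trees (enum_below preds \<delta>) (targets \<delta> (\<lambda>j. enum \<delta> j \<in> W)), g \<delta>)
      \<in> nonM_E"
    using generic by simp
  have dense: "\<exists>w. lev w < \<delta> \<and> le_node (enum \<delta> j) w \<and> w \<in> W" for j
    using wit[of "enum \<delta> j"] \<phi>(2)[OF order_refl] \<delta>(2)[OF lev] by (meson less_trans)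
  have guide: "guide preds \<delta> = g \<delta>"
    using generic_climbs[OF generic dense] by (simp add: guide_def)
  have "preds v \<inter> W \<noteq> {}" if v: "lev v = \<delta>" for v
  proof -
    obtain k where "path preds v k \<in> W"
      using generic_walk_hits[OF generic targets_dense[OF dense \<delta>(1)], of 0 "idx v"] v guide
      by (auto simp: targets_def path_def)
    moreover have "path preds v k \<in> preds v" using path_in_preds \<delta>(1) v by blast
    ultimately show ?thesis by blast
  qed
  then show ?thesis by blast
qed

lemma suslin_tree_rel:
  assumes "\<And>f. stationary {\<delta>. (avoid_guess (seg f \<delta>), g \<delta>) \<in> nonM_E}"
  shows "suslin_tree UNIV tree_rel"
proof (rule suslin_treeI)
  show "\<exists>t. lev t = \<alpha>" for \<alpha> using exists_node by blast
  show "\<exists>v w. t \<in> preds v \<and> t \<in> preds w \<and> lev v = lev w \<and> v \<noteq> w" for t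
  proof -
    obtain \<delta> where "lev t < \<delta>" using strict_upper_bound_omega1[of "{lev t}"] by auto
    from exists_extension[OF this] show ?thesis by metis
  qed
qed (rule sealing[OF assms])

end

lemma exists_node_coding:
  "\<exists>(lev :: omega1 \<Rightarrow> omega1) idx code. node_coding lev idx code"
proof -
  have inf: "infinite (UNIV :: omega1 set)"
    using uncountable_omega1 uncountable_infinite by blast
  have "|UNIV :: nat set| \<le>o |UNIV :: omega1 set|"
    using inf infinite_iff_card_of_nat by blast
  then have "|(UNIV :: omega1 set) \<times> (UNIV :: nat set)| =o |UNIV :: omega1 set|"
    using card_of_Times_infinite_simps(1)[OF inf UNIV_not_empty] by blast
  then obtain h :: "omega1 \<Rightarrow> omega1 \<times> nat" where h: "bij h"
    using card_of_ordIso[of "UNIV :: omega1 set" "UNIV :: (omega1 \<times> nat) set"]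
    by (auto simp: ordIso_symmetric)
  have bool: "|UNIV :: bool set| \<le>o |UNIV :: omega1 set|"
    using inf by (intro ordLess_imp_ordLeq finite_ordLess_infinite) (auto simp: Field_card_of card_of_well_order_on)
  note absorb = ordIso_imp_ordLeq[OF card_of_Times_infinite_simps(1)[OF inf UNIV_not_empty]]
  have "|UNIV :: (omega1 \<times> omega1 \<times> bool) set| \<le>o |UNIV :: omega1 set|"
    by (rule absorb[OF absorb[OF bool, unfolded UNIV_Times_UNIV], unfolded UNIV_Times_UNIV])
  then obtain code :: "omega1 \<times> omega1 \<times> bool \<Rightarrow> omega1" where code: "inj code"
    using card_of_ordLeq[of "UNIV :: (omega1 \<times> omega1 \<times> bool) set" "UNIV :: omega1 set"] by auto
  have "node_coding (fst \<circ> h) (snd \<circ> h) code"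
    using h code by unfold_locales simp_all
  then show ?thesis by blast
qed

theorem theorem4p7:
  assumes "diamond nonM_A nonM_B nonM_E"
  shows "\<exists>(T :: omega1 set) (r :: omega1 rel). suslin_tree T r"
proof -
  obtain lev idx :: "omega1 \<Rightarrow> _" and code where "node_coding lev idx code"
    using exists_node_coding by blast
  then interpret node_coding lev idx code .
  obtain g where g: "\<And>f. stationary {\<delta>. (avoid_guess (seg f \<delta>), g \<delta>) \<in> nonM_E}"
    using assms borel_map_avoid_guess unfolding diamond_def by blast
  interpret tree_construction lev idx code g ..
  show ?thesis using suslin_tree_rel[OF g] by blast
qed

end
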